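(* (Correctness of JIT.) Let $M$ be a well-formed method table consisting of original methods only, and let $\bar s$ be the body of its entry method, $\langle\mathsf{main}!\epsilon\ \bar s,\ \epsilon\rangle\in M$. Then for every environment $E$, $$(\epsilon\ \bar s),\,M\ \rightarrow^*_{\mathcal D}\ (E\ \epsilon),\,M\quad\Longleftrightarrow\quad \exists M'.\ (\epsilon\ \bar s),\,M\ \rightarrow^*_{\mathsf{JIT}}\ (E\ \epsilon),\,M',$$ i.e. the program $\bar s$ runs to the final environment $E$ with the dispatch semantics $\rightarrow_{\mathcal D}$ if and only if it runs to the same environment with the JIT-compilation semantics $\rightarrow_{\mathsf{JIT}}$.
   Context: **Types, sequences.** Types $\tau$ are concrete ($T$) or abstract ($A$). They come from a fixed finite type table whose entries $T!\bar\tau<:A$ declare a concrete type $T$ with field types $\bar\tau$ and a supertype $A$; predefined are the concrete type $\mathsf{Int}$ and the abstract type $\mathsf{Any}$, a supertype of all types. Subtyping $<:$ is a partial order; the only subtype of a concrete type is itself. $\bar x$ is a finite sequence (indexed from 0), $\epsilon$ the empty sequence, juxtaposition is concatenation, $\bar x[\bar k]$ is the sequence of elements of $\bar x$ at indices $\bar k$; $\bar\tau<:\bar\tau'$ is pointwise (equal lengths). $\bar T$ always denotes a sequence of concrete types, so "$\bar\tau[\bar k]=\bar T$" says in particular that these types are all concrete. **Instructions** $s$, each assigning a register $\%i$: $\%i\leftarrow p$ ($p\in\mathbb Z$); $\%i\leftarrow\%j$; $\%i\leftarrow T(\overline{\%k})$ (allocation); $\%i\leftarrow\%j[k]$ (field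 access); dispatched call $\%i\leftarrow\%j\,?\,m(\overline{\%k}):\%l$; direct call $\%i\leftarrow\%j\,?\,m!\bar T(\overline{\%k}):\%l$. **Method tables.** A method table $M$ is a finite set of entries $\langle m!\bar\tau'\,\bar s,\ \bar\tau\rangle$: a method named $m$ with parameter types (signature) $\bar\tau'$, body $\bar s$, and original signature $\bar\tau$. If $\bar\tau'=\bar\tau$ the entry is an original method (its body has no direct calls); otherwise it is a method instance (specialization) of the original method $m!\bar\tau$. An instance with empty body is a stub. $m!\bar\tau'\in M$ means $M$ has an entry with that name and signature, $M[m!\bar\tau']$ is that entry. $\lfloor M\rfloor$ is the table of original methods of $M$. **Dispatch.** $\mathcal D(M,m,\bar T)$ is the method $m!\bar\tau\in M$ with (1) $\bar T<:\bar\tau$ and (2) for all $m!\bar\tau'\in M$, $\bar T<:\bar\tau'$ implies $\bar\tau<:\bar\tau'$; it is undefined if no such method exists. **Type inference** $\mathcal I$ is a fixed partial function: $\mathcal I(M,\bar\tau,\bar s)=\bar\tau'$ gives one type per instruction of $\bar s$ (type of its register), for parameter types $\bar\tau$. It satisfies Monotonicity: if $\mathcal I(M,\bar\tau,\bar s)=\bar\tau'$ and $\bar\tau''<:\bar\tau$ then $\mathcal I(M,\bar\tau'',\bar s)$ is defined and $<:\bar\tau'$; and Soundness (below). **Well-formedness** $\mathit{WF}(M)$: (1) $\mathsf{main}!\epsilon\in M$; (2) every type in $M$ other than $\mathsf{Int},\mathsf{Any}$ is declared in the type table; (3) in each method registers are numbered consecutively from 0, first parameters then instructions, and an instruction assigning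 $\%k$ refers only to registers $\%i$ with $i<k$; (4) each original method $m!\bar\tau$ has a non-empty body $\bar s$ without direct calls, and $\mathcal I(\lfloor M\rfloor,\bar\tau,\bar s)$ is defined; (5) distinct entries with the same name have distinct signatures; (6) for each instance with signature $\bar\tau'$ and original signature $\bar\tau\ne\bar\tau'$: $\bar\tau'=\bar T$ is concrete, $\bar T<:\bar\tau$, the original method $m!\bar\tau$ is in $M$, and for every original method $m!\bar\tau''\in M$, $\bar T<:\bar\tau''$ implies $\bar\tau<:\bar\tau''$. **Compilation.** The relation $\bar\tau\vdash s,M\leadsto s',M'$ (register typing $\bar\tau$, instruction $s$ that is not a direct call) and the partial function $\mathit{jit}$ are defined by mutual induction. (a) If $s$ is not a call: $\bar\tau\vdash s,M\leadsto s,M$. (b) If $s=\%i\leftarrow\%j\,?\,m(\overline{\%k}):\%l$ and $\bar\tau[\bar k]$ are not all concrete: $\bar\tau\vdash s,M\leadsto s,M$. (c) If $s$ is as in (b) but $\bar\tau[\bar k]=\bar T$ and $\mathit{jit}(M,m,\bar T)=M'$: $\bar\tau\vdash s,M\leadsto (\%i\leftarrow\%j\,?\,m!\bar T(\overline{\%k}):\%l),M'$. (d) If $m!\bar T\in M$ then $\mathit{jit}(M,m,\bar T)=M$. (e) If $m!\bar T\notin M$, $\mathcal D(M,m,\bar T)$ is $m!\bar\tau'$ with body $s_0\dots s_n$, $\mathcal I(\lfloor M\rfloor,\bar T,s_0\dots s_n)=\bar\tau''$, $M_0=M+\langle m!\bar T\,\epsilon,\bar\tau'\rangle$ (add a stub),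 and $\bar T\,\bar\tau''\vdash s_r,M_r\leadsto s'_r,M_{r+1}$ for $r=0,\dots,n$, then $\mathit{jit}(M,m,\bar T)$ is $M_{n+1}$ with the stub $m!\bar T$ replaced by $\langle m!\bar T\,s'_0\dots s'_n,\bar\tau'\rangle$. **Semantics.** Values $v::=p\mid T(\bar v)$, $\mathrm{typeof}(p)=\mathsf{Int}$, $\mathrm{typeof}(T(\bar v))=T$. An environment $E$ is a sequence of values (contents of registers $\%0,\%1,\dots$); $E+v$ appends. A stack is $F::=\epsilon\mid(E\ \bar s)\cdot F$; a configuration is $F,M$. Steps of $(E\ s\,\bar s)\cdot F,M$: if $s$ is $\%i\leftarrow p$, $\%i\leftarrow\%j$, $\%i\leftarrow T(\overline{\%k})$ or $\%i\leftarrow\%j[k]$, step to $(E+v\ \bar s)\cdot F,M$ with $v=p$, $E[j]$, $T(E[\bar k])$, or the $k$-th field of $E[j]$, respectively; if $s$ is a (dispatched or direct) call with guard $E[j]=0$, step to $(E+E[l]\ \bar s)\cdot F,M$; if $s$ is a dispatched call and $E[j]\neq0$, let $\bar T=\mathrm{typeof}(E[\bar k])$, $M'=\mathit{jit}(M,m,\bar T)$, and step to $(E[\bar k]\ \bar s')\cdot(E\ s\,\bar s)\cdot F,M'$ with $\bar s'$ the body of $\mathcal D(M',m,\bar T)$; if $s$ is a direct call and $E[j]\ne0$, step to $(E[\bar k]\ \bar s')\cdot(E\ s\,\bar s)\cdot F,M$ with $\bar s'$ the body of $M[m!\bar T]$. Return: $(E'\ \epsilon)\cdot(E\ s\,\bar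 s)\cdot F,M\rightarrow(E+\mathrm{last}(E')\ \bar s)\cdot F,M$. There is no step when a needed item is undefined. The step relation is written $\rightarrow_{\mathsf{JIT}}$ when $\mathit{jit}$ is the compiler above, and $\rightarrow_{\mathcal D}$ when $\mathit{jit}$ is replaced by the identity $\mathit{jit}(M,m,\bar T)=M$. A non-empty configuration that cannot step has *erred* if its top frame starts with a dispatched call to some $m$ having an entry in $M$ and $\mathcal D(M,m,\bar T)$ is undefined for the types $\bar T$ of the argument values. Soundness of $\mathcal I$ (for $\rightarrow$ being either of $\rightarrow_{\mathcal D}$, $\rightarrow_{\mathsf{JIT}}$): if $\mathcal I(M,\bar\tau,\bar s)=\bar\tau'$, then for every $E$ with $\mathrm{typeof}(E)<:\bar\tau$ and every $F$: (1) if $(E\ \bar s)\cdot F,M\rightarrow^*F'\cdot F,M'$, where $F'$ is non-empty and not a single frame with no instructions, and the latter cannot step, then it has erred; (2) if $(E\ \bar s)\cdot F,M\rightarrow^*(E\,E'\ \bar s'')\cdot F,M'$, then $\bar s=\bar s'\,\bar s''$ for some $\bar s'$ and $\mathrm{typeof}(E'_i)<:\tau'_i$ for all $i$. *)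

theory Defs
  imports Main
begin

section \<open>Types, instructions and method tables\<close>

datatype ctype = IntT | Struct string

datatype atype = AnyT | Abstract string

datatype ty = is_Conc: Conc ctype | Abs atype

text \<open>A type table maps the name of a declared concrete type to its field types and its declared
  supertype.  \<^term>\<open>IntT\<close> and \<^term>\<open>AnyT\<close> are predefined and need no declaration.\<close>

type_synonym type_table = "string \<Rightarrow> (ty list \<times> atype) option"

type_synonym subtype_rel = "ty \<Rightarrow> ty \<Rightarrow> bool"

text \<open>The subtype relation is an arbitrary partial order that is compatible with the type table;
  on lists of types it is used pointwise, as \<^term>\<open>list_all2 sub\<close>.\<close>

locale type_hierarchy =
  fixes D :: type_table and sub :: subtype_rel
  assumes finite_table: "finite (dom D)"
    and sub_refl: "sub t t"
    and sub_antisym: "sub t u \<Longrightarrow> sub u t \<Longrightarrow> t = u"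
    and sub_trans: "sub t u \<Longrightarrow> sub u v \<Longrightarrow> sub t v"
    and sub_Any: "sub t (Abs AnyT)"
    and sub_declared: "D c = Some (fields, A) \<Longrightarrow> sub (Conc (Struct c)) (Abs A)"
    and sub_concrete: "sub t (Conc T) \<Longrightarrow> t = Conc T"

text \<open>The first argument of every instruction is the assigned register.
  \<open>Call i j m ks l\<close> is the dispatched call \<open>%i \<leftarrow> %j ? m(%ks) : %l\<close> and
  \<open>DirectCall i j m Ts ks l\<close> is the direct call \<open>%i \<leftarrow> %j ? m!Ts(%ks) : %l\<close>.\<close>

datatype instr =
    Const nat int
  | Move nat nat
  | New nat ctype "nat list"
  | Field nat nat nat
  | Call nat nat string "nat list" nat
  | DirectCall nat nat string "ctype list" "nat list" nat

fun target :: "instr \<Rightarrow> nat" where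
  "target (Const i p) = i"
| "target (Move i j) = i"
| "target (New i T ks) = i"
| "target (Field i j k) = i"
| "target (Call i j m ks l) = i"
| "target (DirectCall i j m Ts ks l) = i"

fun used_regs :: "instr \<Rightarrow> nat set" where
  "used_regs (Const i p) = {}"
| "used_regs (Move i j) = {j}"
| "used_regs (New i T ks) = set ks"
| "used_regs (Field i j k) = {j}"
| "used_regs (Call i j m ks l) = {j, l} \<union> set ks"
| "used_regs (DirectCall i j m Ts ks l) = {j, l} \<union> set ks"

fun instr_types :: "instr \<Rightarrow> ty set" where
  "instr_types (New i T ks) = {Conc T}"
| "instr_types (DirectCall i j m Ts ks l) = Conc ` set Ts"
| "instr_types _ = {}"

fun is_direct_call :: "instr \<Rightarrow> bool" where
  "is_direct_call (DirectCall i j m Ts ks l) = True"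
| "is_direct_call _ = False"

fun is_call :: "instr \<Rightarrow> bool" where
  "is_call (Call i j m ks l) = True"
| "is_call (DirectCall i j m Ts ks l) = True"
| "is_call _ = False"

datatype mentry =
  Entry (mname: string) (msig: "ty list") (mbody: "instr list") (morig: "ty list")

text \<open>Method tables are finite sets of entries; finiteness is required explicitly.\<close>

type_synonym mtable = "mentry set"

definition is_original :: "mentry \<Rightarrow> bool" where
  "is_original e \<longleftrightarrow> msig e = morig e"

definition originals :: "mtable \<Rightarrow> mtable" where
  "originals M = {e \<in> M. is_original e}"

definition has_method :: "mtable \<Rightarrow> string \<Rightarrow> ty list \<Rightarrow> bool" where
  "has_method M m ts \<longleftrightarrow> (\<exists>e\<in>M. mname e = m \<and> msig e = ts)"

text \<open>``The element satisfying \<open>P\<close>'' as a partial notion.  For lookup and dispatch in a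
  well-formed table existence already implies uniqueness.\<close>

definition the_unique :: "('a \<Rightarrow> bool) \<Rightarrow> 'a option" where
  "the_unique P = (if \<exists>!x. P x then Some (THE x. P x) else None)"

definition lookup :: "mtable \<Rightarrow> string \<Rightarrow> ty list \<Rightarrow> mentry option" where
  "lookup M m ts = the_unique (\<lambda>e. e \<in> M \<and> mname e = m \<and> msig e = ts)"

definition dispatch :: "subtype_rel \<Rightarrow> mtable \<Rightarrow> string \<Rightarrow> ctype list \<Rightarrow> mentry option" where
  "dispatch sub M m Ts = the_unique (\<lambda>e. e \<in> M \<and> mname e = m
     \<and> list_all2 sub (map Conc Ts) (msig e)
     \<and> (\<forall>e'\<in>M. mname e' = m \<longrightarrow> list_all2 sub (map Conc Ts) (msig e')
           \<longrightarrow> list_all2 sub (msig e) (msig e')))"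

section \<open>Well-formedness\<close>

text \<open>\<open>infer M ts ss = Some ts'\<close>: for parameter types \<open>ts\<close>, the registers assigned
  by the instructions \<open>ss\<close> have types \<open>ts'\<close>.\<close>

type_synonym inference = "mtable \<Rightarrow> ty list \<Rightarrow> instr list \<Rightarrow> ty list option"

text \<open>An abstract type is declared by occurring as the supertype of an entry.\<close>

fun declared :: "type_table \<Rightarrow> ty \<Rightarrow> bool" where
  "declared D (Conc IntT) = True"
| "declared D (Conc (Struct c)) = (c \<in> dom D)"
| "declared D (Abs AnyT) = True"
| "declared D (Abs (Abstract a)) = (\<exists>c fields. D c = Some (fields, Abstract a))"

definition entry_types :: "mentry \<Rightarrow> ty set" where
  "entry_types e = set (msig e) \<union> set (morig e) \<union> (\<Union>s\<in>set (mbody e). instr_types s)"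

definition registers_ok :: "mentry \<Rightarrow> bool" where
  "registers_ok e \<longleftrightarrow> (\<forall>r < length (mbody e).
     target (mbody e ! r) = length (msig e) + r
     \<and> (\<forall>i \<in> used_regs (mbody e ! r). i < length (msig e) + r))"

definition WF :: "type_table \<Rightarrow> subtype_rel \<Rightarrow> inference \<Rightarrow> mtable \<Rightarrow> bool" where
  "WF D sub infer M \<longleftrightarrow>
     has_method M ''main'' []
   \<and> (\<forall>e\<in>M. \<forall>t\<in>entry_types e. declared D t)
   \<and> (\<forall>e\<in>M. registers_ok e)
   \<and> (\<forall>e\<in>M. is_original e \<longrightarrow>
        mbody e \<noteq> [] \<and> (\<forall>s\<in>set (mbody e). \<not> is_direct_call s)
        \<and> infer (originals M) (msig e) (mbody e) \<noteq> None)
   \<and> (\<forall>e\<in>M. \<forall>e'\<in>M. e \<noteq> e' \<and> mname e = mname e' \<longrightarrow> msig e \<noteq> msig e')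
   \<and> (\<forall>e\<in>M. \<not> is_original e \<longrightarrow>
        (\<forall>t\<in>set (msig e). is_Conc t)
        \<and> list_all2 sub (msig e) (morig e)
        \<and> has_method (originals M) (mname e) (morig e)
        \<and> (\<forall>e'\<in>originals M. mname e' = mname e \<longrightarrow> list_all2 sub (msig e) (msig e')
              \<longrightarrow> list_all2 sub (morig e) (msig e')))"

section \<open>Compilation\<close>

text \<open>\<open>compile sub infer ts s M s' M'\<close> compiles one instruction under the register typing
  \<open>ts\<close>, \<open>compile_seq\<close> threads the method table through a sequence of instructions, and
  \<open>jit sub infer M m Ts M'\<close> is the graph of the partial function \<open>jit(M, m, Ts) = M'\<close>.
  There is no rule for compiling direct calls.\<close>

inductive compile :: "subtype_rel \<Rightarrow> inference \<Rightarrow> ty list \<Rightarrow> instr \<Rightarrow> mtable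
      \<Rightarrow> instr \<Rightarrow> mtable \<Rightarrow> bool"
  and compile_seq :: "subtype_rel \<Rightarrow> inference \<Rightarrow> ty list \<Rightarrow> instr list \<Rightarrow> mtable
      \<Rightarrow> instr list \<Rightarrow> mtable \<Rightarrow> bool"
  and jit :: "subtype_rel \<Rightarrow> inference \<Rightarrow> mtable \<Rightarrow> string \<Rightarrow> ctype list \<Rightarrow> mtable \<Rightarrow> bool"
  for sub :: subtype_rel and infer :: inference
where
  compile_no_call:
    "\<not> is_call s \<Longrightarrow> compile sub infer ts s M s M"
| compile_abstract_args:
    "\<lbrakk> \<forall>k\<in>set ks. k < length ts; \<exists>k\<in>set ks. \<not> is_Conc (ts ! k) \<rbrakk>
     \<Longrightarrow> compile sub infer ts (Call i j m ks l) M (Call i j m ks l) M"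
| compile_concrete_args:
    "\<lbrakk> \<forall>k\<in>set ks. k < length ts; map (\<lambda>k. ts ! k) ks = map Conc Ts; jit sub infer M m Ts M' \<rbrakk>
     \<Longrightarrow> compile sub infer ts (Call i j m ks l) M (DirectCall i j m Ts ks l) M'"
| compile_seq_Nil:
    "compile_seq sub infer ts [] M [] M"
| compile_seq_Cons:
    "\<lbrakk> compile sub infer ts s M s' M'; compile_seq sub infer ts ss M' ss' M'' \<rbrakk>
     \<Longrightarrow> compile_seq sub infer ts (s # ss) M (s' # ss') M''"
| jit_present:
    "has_method M m (map Conc Ts) \<Longrightarrow> jit sub infer M m Ts M"
| jit_new:
    "\<lbrakk> \<not> has_method M m (map Conc Ts);
       dispatch sub M m Ts = Some e;
       mbody e \<noteq> [];
       infer (originals M) (map Conc Ts) (mbody e) = Some ts;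
       stub = Entry m (map Conc Ts) [] (msig e);
       compile_seq sub infer (map Conc Ts @ ts) (mbody e) (insert stub M) ss' M' \<rbrakk>
     \<Longrightarrow> jit sub infer M m Ts (insert (Entry m (map Conc Ts) ss' (msig e)) (M' - {stub}))"

lemma jit_functional:
  "compile sub infer ts s M s1 M1 \<Longrightarrow>
     (\<forall>s2 M2. compile sub infer ts s M s2 M2 \<longrightarrow> s1 = s2 \<and> M1 = M2)"
  "compile_seq sub infer ts ss M ss1 M1 \<Longrightarrow>
     (\<forall>ss2 M2. compile_seq sub infer ts ss M ss2 M2 \<longrightarrow> ss1 = ss2 \<and> M1 = M2)"
  "jit sub infer M m Ts M1 \<Longrightarrow> (\<forall>M2. jit sub infer M m Ts M2 \<longrightarrow> M1 = M2)"
proof (induction rule: compile_compile_seq_jit.inducts)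
  case (compile_no_call s ts M)
  then show ?case by (auto elim: compile.cases)
next
  case (compile_abstract_args ks ts i j m l M)
  have "False" if "map (\<lambda>k. ts ! k) ks = map Conc Ts" for Ts
  proof -
    from that have "\<forall>t\<in>set (map (\<lambda>k. ts ! k) ks). is_Conc t" by auto
    with compile_abstract_args show False by auto
  qed
  then show ?case by (auto elim: compile.cases)
next
  case (compile_concrete_args ks ts Ts M m M' i j l)
  have conc: "\<forall>k\<in>set ks. is_Conc (ts ! k)"
  proof -
    from compile_concrete_args have "\<forall>t\<in>set (map (\<lambda>k. ts ! k) ks). is_Conc t" by auto
    then show ?thesis by auto
  qed
  have uniq: "Ts' = Ts" if "map (\<lambda>k. ts ! k) ks = map Conc Ts'" for Ts'
    using that compile_concrete_args(2) by (metis list.inj_map_strong ty.inject(1))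
  show ?case
  proof (intro allI impI)
    fix s2 M2
    assume "compile sub infer ts (Call i j m ks l) M s2 M2"
    then show "DirectCall i j m Ts ks l = s2 \<and> M' = M2"
    proof (cases rule: compile.cases)
      case (compile_concrete_args Ts')
      with uniq have "Ts' = Ts" by blast
      with compile_concrete_args \<open>\<forall>M2. jit sub infer M m Ts M2 \<longrightarrow> M' = M2\<close>
      show ?thesis by blast
    qed (use conc in auto)
  qed
next
  case (compile_seq_Nil ts M)
  then show ?case by (auto elim: compile_seq.cases)
next
  case (compile_seq_Cons ts s M s' M' ss ss' M'')
  show ?case
  proof (intro allI impI)
    fix ss2 M2
    assume "compile_seq sub infer ts (s # ss) M ss2 M2"
    then show "s' # ss' = ss2 \<and> M'' = M2"
      by (cases rule: compile_seq.cases) (use compile_seq_Cons.IH in blast)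
  qed
next
  case (jit_present M m Ts)
  then show ?case by (auto elim: jit.cases)
next
  case (jit_new M m Ts e ts stub ss' M')
  note IH = jit_new.IH
  show ?case
  proof (intro allI impI)
    fix M2
    assume "jit sub infer M m Ts M2"
    then show "insert (Entry m (map Conc Ts) ss' (msig e)) (M' - {stub}) = M2"
    proof (cases rule: jit.cases)
      case jit_present
      with jit_new show ?thesis by blast
    next
      case (jit_new e2 ts2 stub2 ss2 M2')
      have "e2 = e" using \<open>dispatch sub M m Ts = Some e\<close> jit_new by simp
      moreover from this have "ts2 = ts"
        using \<open>infer (originals M) (map Conc Ts) (mbody e) = Some ts\<close> jit_new by simp
      moreover have "stub2 = stub"
        using \<open>e2 = e\<close> \<open>stub = Entry m (map Conc Ts) [] (msig e)\<close> jit_new by simp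
      ultimately show ?thesis using IH jit_new by metis
    qed
  qed
qed

text \<open>The compiler of the dispatch semantics: the identity on method tables.\<close>

definition no_jit :: "mtable \<Rightarrow> string \<Rightarrow> ctype list \<Rightarrow> mtable \<Rightarrow> bool" where
  "no_jit M m Ts M' \<longleftrightarrow> M' = M"

section \<open>Semantics\<close>

datatype val = IntV int | Obj ctype "val list"

fun typeof :: "val \<Rightarrow> ctype" where
  "typeof (IntV p) = IntT"
| "typeof (Obj T vs) = T"

type_synonym env = "val list"

text \<open>The head of the list is the top of the stack.\<close>

type_synonym frame = "env \<times> instr list"
type_synonym config = "frame list \<times> mtable"

definition in_env :: "env \<Rightarrow> nat list \<Rightarrow> bool" where
  "in_env E ks \<longleftrightarrow> (\<forall>k\<in>set ks. k < length E)"

definition regs :: "env \<Rightarrow> nat list \<Rightarrow> val list" where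
  "regs E ks = map (\<lambda>k. E ! k) ks"

text \<open>The step relation is parameterized by the graph \<open>J\<close> of the compiler.\<close>

inductive step ::
  "subtype_rel \<Rightarrow> (mtable \<Rightarrow> string \<Rightarrow> ctype list \<Rightarrow> mtable \<Rightarrow> bool) \<Rightarrow> config \<Rightarrow> config \<Rightarrow> bool"
  for sub J
where
  step_Const:
    "step sub J ((E, Const i p # ss) # F, M) ((E @ [IntV p], ss) # F, M)"
| step_Move:
    "j < length E \<Longrightarrow>
     step sub J ((E, Move i j # ss) # F, M) ((E @ [E ! j], ss) # F, M)"
| step_New:
    "in_env E ks \<Longrightarrow>
     step sub J ((E, New i T ks # ss) # F, M) ((E @ [Obj T (regs E ks)], ss) # F, M)"
| step_Field:
    "\<lbrakk> j < length E; E ! j = Obj T vs; k < length vs \<rbrakk> \<Longrightarrow>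
     step sub J ((E, Field i j k # ss) # F, M) ((E @ [vs ! k], ss) # F, M)"
| step_Call_skip:
    "\<lbrakk> j < length E; E ! j = IntV 0; l < length E \<rbrakk> \<Longrightarrow>
     step sub J ((E, Call i j m ks l # ss) # F, M) ((E @ [E ! l], ss) # F, M)"
| step_DirectCall_skip:
    "\<lbrakk> j < length E; E ! j = IntV 0; l < length E \<rbrakk> \<Longrightarrow>
     step sub J ((E, DirectCall i j m Ts ks l # ss) # F, M) ((E @ [E ! l], ss) # F, M)"
| step_Call:
    "\<lbrakk> j < length E; E ! j \<noteq> IntV 0; in_env E ks; Ts = map typeof (regs E ks);
       J M m Ts M'; dispatch sub M' m Ts = Some e \<rbrakk> \<Longrightarrow>
     step sub J ((E, Call i j m ks l # ss) # F, M)
       ((regs E ks, mbody e) # (E, Call i j m ks l # ss) # F, M')"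
| step_DirectCall:
    "\<lbrakk> j < length E; E ! j \<noteq> IntV 0; in_env E ks; lookup M m (map Conc Ts) = Some e \<rbrakk> \<Longrightarrow>
     step sub J ((E, DirectCall i j m Ts ks l # ss) # F, M)
       ((regs E ks, mbody e) # (E, DirectCall i j m Ts ks l # ss) # F, M)"
| step_Return:
    "E' \<noteq> [] \<Longrightarrow>
     step sub J ((E', []) # (E, s # ss) # F, M) ((E @ [last E'], ss) # F, M)"

abbreviation step_D :: "subtype_rel \<Rightarrow> config \<Rightarrow> config \<Rightarrow> bool" where
  "step_D sub \<equiv> step sub no_jit"

abbreviation step_JIT :: "subtype_rel \<Rightarrow> inference \<Rightarrow> config \<Rightarrow> config \<Rightarrow> bool" where
  "step_JIT sub infer \<equiv> step sub (jit sub infer)"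

section \<open>Requirements on type inference\<close>

text \<open>To be used for configurations that cannot step.\<close>

definition erred :: "subtype_rel \<Rightarrow> config \<Rightarrow> bool" where
  "erred sub c \<longleftrightarrow> (\<exists>E i j m ks l ss F M. c = ((E, Call i j m ks l # ss) # F, M)
     \<and> (\<exists>e\<in>M. mname e = m) \<and> in_env E ks
     \<and> dispatch sub M m (map typeof (regs E ks)) = None)"

definition sound_for :: "subtype_rel \<Rightarrow> inference \<Rightarrow> (config \<Rightarrow> config \<Rightarrow> bool) \<Rightarrow> bool" where
  "sound_for sub infer R \<longleftrightarrow>
    (\<forall>M ts ss ts' E F.
       finite M \<and> infer M ts ss = Some ts'
       \<and> list_all2 sub (map (\<lambda>v. Conc (typeof v)) E) ts \<longrightarrow>
         (\<forall>F' M'. R\<^sup>*\<^sup>* ((E, ss) # F, M) (F' @ F, M')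
            \<and> F' \<noteq> [] \<and> (\<nexists>E'. F' = [(E', [])]) \<and> (\<nexists>c. R (F' @ F, M') c)
            \<longrightarrow> erred sub (F' @ F, M'))
       \<and> (\<forall>E' ss'' M'. R\<^sup>*\<^sup>* ((E, ss) # F, M) ((E @ E', ss'') # F, M')
            \<longrightarrow> (\<exists>ss'. ss = ss' @ ss'')
              \<and> (\<forall>i < length E'. sub (Conc (typeof (E' ! i))) (ts' ! i))))"

locale type_inference = type_hierarchy D sub
  for D :: type_table and sub :: subtype_rel +
  fixes infer :: inference
  assumes infer_length:
      "finite M \<Longrightarrow> infer M ts ss = Some ts' \<Longrightarrow> length ts' = length ss"
    and infer_mono:
      "finite M \<Longrightarrow> infer M ts ss = Some ts' \<Longrightarrow> list_all2 sub us ts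
       \<Longrightarrow> \<exists>us'. infer M us ss = Some us' \<and> list_all2 sub us' ts'"
    and sound_D: "sound_for sub infer (step_D sub)"
    and sound_JIT: "sound_for sub infer (step_JIT sub infer)"

end

theory Submission
  imports Defs
begin

text \<open>The two semantics run in lockstep.  A JIT stack differs from the corresponding dispatch stack
  only in that some dispatched calls are replaced by direct calls for the inferred argument types.
  Each frame of the dispatch stack is reachable from its initial state on top of the frames below
  it, so soundness of inference applies to it; a concrete type has no proper subtypes, so the
  types inferred for a direct call are those of the actual arguments, and the target of the direct call
  is a compiled copy of the method that dispatch selects.  Hence every JIT step is matched by a
  dispatch step.  Conversely, since dispatch steps are deterministic, it only remains to see that
  the JIT run is not stuck while the dispatch run is not (a priori, compilation of
  dead code could fail): by soundness a stuck JIT run has erred, but then dispatch in the original table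
  is undefined as well.\<close>

section \<open>Determinism of the dispatch semantics\<close>

lemma the_unique_eq_Some: "the_unique P = Some x \<longleftrightarrow> P x \<and> (\<forall>y. P y \<longrightarrow> y = x)"
  unfolding the_unique_def by (smt (verit, best) option.inject option.distinct(1) theI_unique)

text \<open>Allows the dispatch step found to match a JIT step to be identified with a dispatch step
  given beforehand.\<close>

lemma step_no_jit_functional:
  assumes "step sub no_jit c c1" and "step sub no_jit c c2"
  shows "c1 = c2"
  using assms(1)
proof (cases rule: step.cases)
  case step_Const
  from assms(2)[unfolded step_Const] show ?thesis
    by (cases rule: step.cases) (use step_Const in auto)
next
  case step_Move
  from assms(2)[unfolded step_Move] show ?thesis
    by (cases rule: step.cases) (use step_Move in auto)
next
  case step_New
  from assms(2)[unfolded step_New] show ?thesis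
    by (cases rule: step.cases) (use step_New in auto)
next
  case step_Field
  from assms(2)[unfolded step_Field(1)] show ?thesis
    by (cases rule: step.cases) (use step_Field in auto)
next
  case step_Call_skip
  from assms(2)[unfolded step_Call_skip(1)] show ?thesis
    by (cases rule: step.cases) (use step_Call_skip in auto)
next
  case step_DirectCall_skip
  from assms(2)[unfolded step_DirectCall_skip(1)] show ?thesis
    by (cases rule: step.cases) (use step_DirectCall_skip in auto)
next
  case step_Call
  from assms(2)[unfolded step_Call(1)] show ?thesis
    by (cases rule: step.cases) (use step_Call in \<open>auto simp: no_jit_def\<close>)
next
  case step_DirectCall
  from assms(2)[unfolded step_DirectCall(1)] show ?thesis
    by (cases rule: step.cases) (use step_DirectCall in auto)
next
  case step_Return
  from assms(2)[unfolded step_Return(1)] show ?thesis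
    by (cases rule: step.cases) (use step_Return in auto)
qed

section \<open>Dispatch in tables with distinct signatures\<close>

definition distinct_sigs :: "mtable \<Rightarrow> bool" where
  "distinct_sigs M \<longleftrightarrow>
     (\<forall>e\<in>M. \<forall>e'\<in>M. mname e = mname e' \<longrightarrow> msig e = msig e' \<longrightarrow> e = e')"

text \<open>A set rather than an absence condition, because compilation is nested: a recursive
  \<open>jit\<close> starts with the pending stubs of the enclosing compilations and must leave
  exactly those.\<close>

definition stubs :: "mtable \<Rightarrow> mtable" where
  "stubs M = {e \<in> M. mbody e = []}"

context type_hierarchy
begin

lemma list_sub_refl: "list_all2 sub ts ts"
  by (simp add: list_all2_refl sub_refl)

lemma list_sub_antisym: "list_all2 sub ts us \<Longrightarrow> list_all2 sub us ts \<Longrightarrow> ts = us"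
  by (auto simp: list_all2_conv_all_nth intro!: nth_equalityI sub_antisym)

lemma list_sub_concrete: "list_all2 sub ts (map Conc Ts) \<Longrightarrow> ts = map Conc Ts"
  by (auto simp: list_all2_conv_all_nth intro!: nth_equalityI sub_concrete)

text \<open>Two least applicable methods have equal signatures by antisymmetry, hence are equal; so
  uniqueness in \<open>the_unique\<close> comes for free.\<close>

lemma dispatch_eq_Some:
  assumes "distinct_sigs M"
  shows "dispatch sub M m Ts = Some e \<longleftrightarrow>
    e \<in> M \<and> mname e = m \<and> list_all2 sub (map Conc Ts) (msig e)
     \<and> (\<forall>e'\<in>M. mname e' = m \<longrightarrow> list_all2 sub (map Conc Ts) (msig e')
           \<longrightarrow> list_all2 sub (msig e) (msig e'))"
  (is "_ \<longleftrightarrow> ?P e")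
proof -
  have uniq: "e' = e" if e: "?P e" and e': "?P e'" for e e'
  proof -
    have "msig e' = msig e"
      by (rule list_sub_antisym) (use e e' in simp_all)
    then show ?thesis using e e' assms by (simp add: distinct_sigs_def)
  qed
  show ?thesis
    unfolding dispatch_def the_unique_eq_Some
    by (rule iffI, erule conjunct1, rule conjI, assumption, intro allI impI, rule uniq)
qed

lemma dispatch_exact_sig:
  assumes "distinct_sigs M" "e \<in> M" "mname e = m" "msig e = map Conc Ts"
  shows "dispatch sub M m Ts = Some e"
  using assms by (simp add: dispatch_eq_Some list_sub_refl)

lemma lookup_imp_dispatch:
  assumes "distinct_sigs M" "lookup M m (map Conc Ts) = Some e"
  shows "dispatch sub M m Ts = Some e"
  using assms by (intro dispatch_exact_sig) (auto simp: lookup_def the_unique_eq_Some)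

end

section \<open>Refinement of instructions by compilation\<close>

text \<open>Records that the inferred argument types are \<open>Ts\<close>, but not that the table
  contains the target: a missing target would leave the JIT run stuck without having erred, which
  soundness rules out.\<close>

definition instr_refines :: "ty list \<Rightarrow> instr \<Rightarrow> instr \<Rightarrow> bool" where
  "instr_refines ts s s' \<longleftrightarrow> s' = s \<and> \<not> is_direct_call s \<or>
     (\<exists>i j m Ts ks l. s = Call i j m ks l \<and> s' = DirectCall i j m Ts ks l
        \<and> (\<forall>k\<in>set ks. k < length ts) \<and> map (\<lambda>k. ts ! k) ks = map Conc Ts)"

lemma instr_refines_simps [simp]:
  "instr_refines ts s (Const i p) \<longleftrightarrow> s = Const i p"
  "instr_refines ts s (Move i j) \<longleftrightarrow> s = Move i j"
  "instr_refines ts s (New i T ks) \<longleftrightarrow> s = New i T ks"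
  "instr_refines ts s (Field i j k) \<longleftrightarrow> s = Field i j k"
  "instr_refines ts s (Call i j m ks l) \<longleftrightarrow> s = Call i j m ks l"
  "instr_refines ts s (DirectCall i j m Ts ks l) \<longleftrightarrow> s = Call i j m ks l
     \<and> (\<forall>k\<in>set ks. k < length ts) \<and> map (\<lambda>k. ts ! k) ks = map Conc Ts"
  by (auto simp: instr_refines_def)

section \<open>The table invariant and dispatch in compiled tables\<close>

locale jit_program = type_inference D sub infer
  for D :: type_table and sub :: subtype_rel and infer :: inference +
  fixes P :: mtable
  assumes finite_P: "finite P"
    and WF_P: "WF D sub infer P"
    and originals_P: "originals P = P"
begin

text \<open>Inference refers to \<open>P\<close> because \<open>jit\<close> infers over
  \<open>originals M\<close>, which the table invariant equates with \<open>P\<close>.\<close>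

definition compiled :: "ctype list \<Rightarrow> instr list \<Rightarrow> instr list \<Rightarrow> bool" where
  "compiled Ts ss ss' \<longleftrightarrow> (\<exists>ts. infer P (map Conc Ts) ss = Some ts
     \<and> list_all2 (instr_refines (map Conc Ts @ ts)) ss ss')"

text \<open>Empty bodies are allowed because the invariant also has to hold while methods are being
  compiled and their stubs are in the table.\<close>

definition table_inv :: "mtable \<Rightarrow> bool" where
  "table_inv M \<longleftrightarrow> originals M = P \<and> distinct_sigs M
     \<and> (\<forall>e\<in>M. \<not> is_original e \<longrightarrow> (\<exists>Ts e0. msig e = map Conc Ts
          \<and> dispatch sub P (mname e) Ts = Some e0
          \<and> (mbody e = [] \<or> compiled Ts (mbody e0) (mbody e))))"

lemma distinct_sigs_P: "distinct_sigs P"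
  using WF_P unfolding WF_def distinct_sigs_def by metis

lemma table_inv_P: "table_inv P"
  using originals_P distinct_sigs_P by (auto simp: table_inv_def originals_def)

lemma body_P:
  assumes "e \<in> P"
  shows "mbody e \<noteq> []" and "s \<in> set (mbody e) \<Longrightarrow> \<not> is_direct_call s"
    and "\<exists>ts. infer P (msig e) (mbody e) = Some ts"
  using assms WF_P originals_P unfolding WF_def originals_def by auto

lemma stubs_P: "stubs P = {}"
  using body_P(1) by (auto simp: stubs_def)

text \<open>Monotonicity carries inference from the declared parameter types to \<open>Ts\<close>,
  and an original body has no direct calls, so each instruction refines itself. Calls of originals
  and of instances can thus be treated alike.\<close>

lemma compiled_refl:
  assumes "e \<in> P" "list_all2 sub (map Conc Ts) (msig e)"
  shows "compiled Ts (mbody e) (mbody e)"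
proof -
  obtain ts where "infer P (map Conc Ts) (mbody e) = Some ts"
    using body_P(3)[OF assms(1)] infer_mono[OF finite_P _ assms(2)] by blast
  then show ?thesis
    using body_P(2)[OF assms(1)]
    by (auto simp: compiled_def instr_refines_def list_all2_same)
qed

lemma original_in_P: "table_inv M \<Longrightarrow> e \<in> M \<Longrightarrow> is_original e \<Longrightarrow> e \<in> P"
  by (auto simp: table_inv_def originals_def)

lemma P_subset: "table_inv M \<Longrightarrow> P \<subseteq> M"
  by (auto simp: table_inv_def originals_def)

text \<open>The signature of an instance is concrete, and concrete types have no proper
  subtypes.\<close>

lemma applicable_instance:
  assumes "table_inv M" "e \<in> M" "\<not> is_original e" "list_all2 sub (map Conc Ts) (msig e)"
  shows "msig e = map Conc Ts"
  using assms list_sub_concrete unfolding table_inv_def by metis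

lemma dispatch_original:
  assumes inv: "table_inv M" and d: "dispatch sub M m Ts = Some e" and orig: "is_original e"
  shows "dispatch sub P m Ts = Some e"
proof -
  have "distinct_sigs M" using inv by (simp add: table_inv_def)
  then show ?thesis
    using d original_in_P[OF inv _ orig] P_subset[OF inv] distinct_sigs_P
    by (auto simp: dispatch_eq_Some)
qed

text \<open>A selected original is also least in the smaller table \<open>P\<close>. A selected
  instance has signature exactly \<open>Ts\<close>, so the invariant already names its source in
  \<open>P\<close>; without stubs its body is compiled.\<close>

lemma dispatch_compiled:
  assumes inv: "table_inv M" and no_stubs: "stubs M = {}"
    and d: "dispatch sub M m Ts = Some e"
  obtains e0 where "dispatch sub P m Ts = Some e0" "compiled Ts (mbody e0) (mbody e)"
proof -
  have e: "e \<in> M" "mname e = m" "list_all2 sub (map Conc Ts) (msig e)"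
    using d inv by (auto simp: dispatch_eq_Some table_inv_def)
  show thesis
  proof (cases "is_original e")
    case True
    with that show thesis
      using dispatch_original[OF inv d True] compiled_refl original_in_P[OF inv] e by blast
  next
    case False
    then obtain Ts' e0 where *: "msig e = map Conc Ts'" "dispatch sub P m Ts' = Some e0"
      "compiled Ts' (mbody e0) (mbody e)"
      using inv e no_stubs unfolding table_inv_def stubs_def by blast
    have "map Conc Ts' = map Conc Ts"
      using applicable_instance[OF inv e(1) False e(3)] * by simp
    then have "Ts' = Ts" by (metis list.inj_map_strong ty.inject(1))
    with * that show thesis by blast
  qed
qed

text \<open>Adding instances cannot create ambiguity: an instance for \<open>Ts\<close> is itself
  least, and without one the applicable methods are those of \<open>P\<close>.\<close>

lemma dispatch_defined:
  assumes inv: "table_inv M" and d: "dispatch sub P m Ts = Some e0"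
  shows "dispatch sub M m Ts \<noteq> None"
proof (cases "has_method M m (map Conc Ts)")
  case True
  then show ?thesis
    using inv dispatch_exact_sig unfolding has_method_def table_inv_def by blast
next
  case False
  have "is_original e" if "e \<in> M" "mname e = m" "list_all2 sub (map Conc Ts) (msig e)" for e
    using applicable_instance[OF inv that(1) _ that(3)] that False
    unfolding has_method_def by blast
  then have "dispatch sub M m Ts = Some e0"
    using inv d P_subset[OF inv] original_in_P[OF inv] distinct_sigs_P
    by (auto simp: dispatch_eq_Some table_inv_def)
  then show ?thesis by simp
qed

section \<open>Compilation preserves the invariant\<close>

text \<open>Serves both for adding a stub and for adding the finished method, whence the disjunction
  on \<open>ss\<close>.\<close>

lemma table_inv_insert:
  assumes inv: "table_inv M" and new: "\<not> has_method M m (map Conc Ts)"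
    and orig: "map Conc Ts \<noteq> ts0"
    and d: "dispatch sub P m Ts = Some e0"
    and b: "ss = [] \<or> compiled Ts (mbody e0) ss"
  shows "table_inv (insert (Entry m (map Conc Ts) ss ts0) M)"
  unfolding table_inv_def
proof (intro conjI)
  show "originals (insert (Entry m (map Conc Ts) ss ts0) M) = P"
    using inv orig by (auto simp: table_inv_def originals_def is_original_def)
  show "distinct_sigs (insert (Entry m (map Conc Ts) ss ts0) M)"
    using inv new unfolding table_inv_def distinct_sigs_def has_method_def by (auto; metis)
  show "\<forall>e\<in>insert (Entry m (map Conc Ts) ss ts0) M. \<not> is_original e \<longrightarrow>
      (\<exists>Ts e0. msig e = map Conc Ts \<and> dispatch sub P (mname e) Ts = Some e0
        \<and> (mbody e = [] \<or> compiled Ts (mbody e0) (mbody e)))"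
    using inv d b unfolding table_inv_def by auto
qed

lemma table_inv_remove_instance:
  "table_inv M \<Longrightarrow> \<not> is_original e \<Longrightarrow> table_inv (M - {e})"
  unfolding table_inv_def originals_def distinct_sigs_def by auto

text \<open>Each \<open>jit\<close> adds one stub and replaces it by a non-empty body, so nested
  compilations leave the pending stubs untouched.\<close>

lemma compile_preserves_inv:
  "compile sub infer ts s M s' M' \<Longrightarrow> table_inv M \<longrightarrow>
     table_inv M' \<and> stubs M' = stubs M \<and> instr_refines ts s s'"
  "compile_seq sub infer ts ss M ss' M' \<Longrightarrow> table_inv M \<longrightarrow>
     table_inv M' \<and> stubs M' = stubs M \<and> list_all2 (instr_refines ts) ss ss'"
  "jit sub infer M m Ts M' \<Longrightarrow> table_inv M \<longrightarrow> table_inv M' \<and> stubs M' = stubs M"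
proof (induction rule: compile_compile_seq_jit.inducts)
  case (compile_no_call s ts M)
  then show ?case by (cases s) (auto simp: instr_refines_def)
next
  case (jit_new M m Ts e ts stub ss' M')
  show ?case
  proof
    assume inv: "table_inv M"
    note new = \<open>\<not> has_method M m (map Conc Ts)\<close> and d = \<open>dispatch sub M m Ts = Some e\<close>
    have "distinct_sigs M" using inv by (simp add: table_inv_def)
    then have e: "e \<in> M" "mname e = m" "list_all2 sub (map Conc Ts) (msig e)"
      using d by (auto simp: dispatch_eq_Some)
    have sig: "map Conc Ts \<noteq> msig e"
      using new e by (auto simp: has_method_def)
    \<comment> \<open>An applicable instance would have signature \<open>map Conc Ts\<close>, which
      is absent from \<open>M\<close>.\<close>
    then have orig: "is_original e"
      using applicable_instance[OF inv e(1) _ e(3)] by auto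
    have dP: "dispatch sub P m Ts = Some e"
      using dispatch_original[OF inv d orig] .
    have stub: "stub = Entry m (map Conc Ts) [] (msig e)" by fact
    have "table_inv (insert stub M)"
      unfolding stub by (rule table_inv_insert[OF inv new sig dP]) simp
    with jit_new.IH have inv': "table_inv M'" and stubs': "stubs M' = stubs (insert stub M)"
      and ref: "list_all2 (instr_refines (map Conc Ts @ ts)) (mbody e) ss'"
      by auto
    have "originals M = P" using inv by (simp add: table_inv_def)
    then have comp: "compiled Ts (mbody e) ss'"
      using \<open>infer (originals M) _ _ = _\<close> ref by (auto simp: compiled_def)
    have "ss' \<noteq> []" using ref \<open>mbody e \<noteq> []\<close> by auto
    have stubs'': "stubs M' = insert stub (stubs M)"
      unfolding stubs' by (auto simp: stubs_def stub)
    \<comment> \<open>The stub survives the nested compilations. By distinct signatures it is the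
      only entry for \<open>m\<close> at \<open>Ts\<close>, so removing it frees the signature for
      the finished method.\<close>
    then have "stub \<in> M'" unfolding stubs_def by blast
    have "stub \<notin> M" using new unfolding stub has_method_def by auto
    have new': "\<not> has_method (M' - {stub}) m (map Conc Ts)"
      using inv' \<open>stub \<in> M'\<close> unfolding stub has_method_def table_inv_def distinct_sigs_def
      by fastforce
    have "\<not> is_original stub" using sig unfolding stub is_original_def by simp
    from table_inv_remove_instance[OF inv' this]
    have "table_inv (insert (Entry m (map Conc Ts) ss' (msig e)) (M' - {stub}))"
      by (rule table_inv_insert[OF _ new' sig dP]) (use comp in simp)
    moreover have "stubs (insert (Entry m (map Conc Ts) ss' (msig e)) (M' - {stub})) = stubs M"
      using stubs'' \<open>stub \<notin> M\<close> \<open>ss' \<noteq> []\<close> unfolding stubs_def by auto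
    ultimately show "table_inv (insert (Entry m (map Conc Ts) ss' (msig e)) (M' - {stub})) \<and>
      stubs (insert (Entry m (map Conc Ts) ss' (msig e)) (M' - {stub})) = stubs M" by blast
  qed
qed auto

section \<open>Simulation between JIT and dispatch stacks\<close>

text \<open>The reachability premises say that the top frame was entered by a call and run from its initial
  state \<open>(E0, body)\<close>, so that soundness of inference applies to it even after inner calls have returned.\<close>

inductive simulates :: "frame list \<Rightarrow> frame list \<Rightarrow> bool" where
  simulates_Nil: "simulates [] []"
| simulates_Cons:
    "\<lbrakk> simulates F F';
       F = [] \<or> step_D sub (F, P) ((E0, body) # F, P);
       infer P (map Conc (map typeof E0)) body = Some ts;
       (step_D sub)\<^sup>*\<^sup>* ((E0, body) # F, P) ((E0 @ E1, ss) # F, P);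
       list_all2 (instr_refines (map Conc (map typeof E0) @ ts)) ss ss' \<rbrakk>
     \<Longrightarrow> simulates ((E0 @ E1, ss) # F) ((E0 @ E1, ss') # F')"

lemma simulates_ConsE:
  assumes "simulates C ((E, ss') # F')"
  obtains F E0 body ts E1 ss where "C = (E0 @ E1, ss) # F" "E = E0 @ E1"
    "simulates F F'" "F = [] \<or> step_D sub (F, P) ((E0, body) # F, P)"
    "infer P (map Conc (map typeof E0)) body = Some ts"
    "(step_D sub)\<^sup>*\<^sup>* ((E0, body) # F, P) ((E0 @ E1, ss) # F, P)"
    "list_all2 (instr_refines (map Conc (map typeof E0) @ ts)) ss ss'"
  using assms
proof (cases rule: simulates.cases)
  case (simulates_Cons F E0 body ts E1 ss)
  then show thesis by (rule that)
qed

lemma simulates_instrE: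
  assumes "simulates C ((E, s' # ss') # F')"
  obtains F E0 body ts E1 s ss where "C = (E, s # ss) # F" "E = E0 @ E1"
    "simulates F F'" "F = [] \<or> step_D sub (F, P) ((E0, body) # F, P)"
    "infer P (map Conc (map typeof E0)) body = Some ts"
    "(step_D sub)\<^sup>*\<^sup>* ((E0, body) # F, P) ((E0 @ E1, s # ss) # F, P)"
    "list_all2 (instr_refines (map Conc (map typeof E0) @ ts)) ss ss'"
    "instr_refines (map Conc (map typeof E0) @ ts) s s'"
proof -
  from assms obtain F E0 body ts E1 ss0 where C: "C = (E0 @ E1, ss0) # F" "E = E0 @ E1"
    and F: "simulates F F'" "F = [] \<or> step_D sub (F, P) ((E0, body) # F, P)"
      "infer P (map Conc (map typeof E0)) body = Some ts"
      "(step_D sub)\<^sup>*\<^sup>* ((E0, body) # F, P) ((E0 @ E1, ss0) # F, P)"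
    and ss0: "list_all2 (instr_refines (map Conc (map typeof E0) @ ts)) ss0 (s' # ss')"
    by (rule simulates_ConsE)
  from ss0 obtain s ss where "ss0 = s # ss"
    "instr_refines (map Conc (map typeof E0) @ ts) s s'"
    "list_all2 (instr_refines (map Conc (map typeof E0) @ ts)) ss ss'"
    unfolding list_all2_Cons2 by blast
  with that[of s ss F E0 E1 body ts] C F show thesis by simp
qed

text \<open>The last premise is a run rather than a single step: on return, the call of the caller
  has been carried out by the whole run of its callee.\<close>

lemma simulates_advance:
  assumes "simulates F F'" "F = [] \<or> step_D sub (F, P) ((E0, body) # F, P)"
    "infer P (map Conc (map typeof E0)) body = Some ts"
    "(step_D sub)\<^sup>*\<^sup>* ((E0, body) # F, P) ((E0 @ E1, s # ss) # F, P)"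
    "list_all2 (instr_refines (map Conc (map typeof E0) @ ts)) ss ss'"
    "(step_D sub)\<^sup>*\<^sup>* ((E0 @ E1, s # ss) # F, P) (((E0 @ E1) @ [v], ss) # F, P)"
  shows "simulates (((E0 @ E1) @ [v], ss) # F) (((E0 @ E1) @ [v], ss') # F')"
  using simulates_Cons[OF assms(1-3), of "E1 @ [v]" ss ss']
    rtranclp_trans[OF assms(4,6)] assms(5) by simp

text \<open>Covers all instructions that neither push nor pop a frame. The second premise ranges
  over all \<open>s\<close>, since the instruction on the dispatch side is known only up to
  refinement.\<close>

lemma simulates_exec:
  assumes "simulates C ((E, s' # ss') # F')"
    and step: "\<And>ts s ss F. instr_refines ts s s' \<Longrightarrow>
      step_D sub ((E, s # ss) # F, P) ((E @ [v], ss) # F, P)"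
  shows "\<exists>C1. step_D sub (C, P) (C1, P) \<and> simulates C1 ((E @ [v], ss') # F')"
proof -
  obtain F E0 body ts E1 s ss where C: "C = (E, s # ss) # F" and E: "E = E0 @ E1"
    and F: "simulates F F'" "F = [] \<or> step_D sub (F, P) ((E0, body) # F, P)"
      "infer P (map Conc (map typeof E0)) body = Some ts"
      "(step_D sub)\<^sup>*\<^sup>* ((E0, body) # F, P) ((E0 @ E1, s # ss) # F, P)"
      "list_all2 (instr_refines (map Conc (map typeof E0) @ ts)) ss ss'"
    and s: "instr_refines (map Conc (map typeof E0) @ ts) s s'"
    by (rule simulates_instrE[OF assms(1)])
  have st: "step_D sub (C, P) ((E @ [v], ss) # F, P)" unfolding C by (rule step[OF s])
  then show ?thesis
    using simulates_advance[OF F, of v] unfolding C E by blast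
qed

lemma simulates_call:
  assumes C: "simulates ((E, s # ss) # F) ((E, s' # ss') # F')"
    and st: "step_D sub ((E, s # ss) # F, P) ((E', body) # (E, s # ss) # F, P)"
    and comp: "compiled (map typeof E') body body'"
  shows "simulates ((E', body) # (E, s # ss) # F) ((E', body') # (E, s' # ss') # F')"
proof -
  obtain ts where "infer P (map Conc (map typeof E')) body = Some ts"
    "list_all2 (instr_refines (map Conc (map typeof E') @ ts)) body body'"
    using comp unfolding compiled_def by blast
  then show ?thesis using simulates_Cons[OF C, of E' body ts "[]" body body'] st by simp
qed

text \<open>Parameters have exactly the types in the typing; for later registers soundness gives an
  upper bound. Where that bound is concrete it is an equality.\<close>

lemma inferred_concrete_args:
  assumes inf: "infer P (map Conc (map typeof E0)) body = Some ts"
    and reach: "(step_D sub)\<^sup>*\<^sup>* ((E0, body) # F, P) ((E0 @ E1, ss) # F, P)"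
    and ks: "map (\<lambda>k. (map Conc (map typeof E0) @ ts) ! k) ks = map Conc Ts"
    and env: "in_env (E0 @ E1) ks"
  shows "map typeof (regs (E0 @ E1) ks) = Ts"
proof -
  have "list_all2 sub (map (\<lambda>v. Conc (typeof v)) E0) (map Conc (map typeof E0))"
    using list_sub_refl by (simp add: comp_def)
  with sound_D inf reach finite_P
  have sound: "sub (Conc (typeof (E1 ! i))) (ts ! i)" if "i < length E1" for i
    using that unfolding sound_for_def by blast
  have "sub (Conc (typeof ((E0 @ E1) ! k))) ((map Conc (map typeof E0) @ ts) ! k)"
    if "k \<in> set ks" for k
    using that env sound by (auto simp: in_env_def nth_append sub_refl)
  moreover have len: "length Ts = length ks"
    using ks by (metis length_map)
  moreover have "(map Conc (map typeof E0) @ ts) ! (ks ! n) = Conc (Ts ! n)" if "n < length ks" for n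
    using that len ks by (metis (no_types, lifting) nth_map)
  ultimately show ?thesis
    using sub_concrete by (intro nth_equalityI) (auto simp: regs_def, metis nth_mem ty.inject(1))
qed

section \<open>Matching single steps, and progress of the JIT run\<close>

lemma step_JIT_simulated:
  assumes "step_JIT sub infer (C', M) (C1', M1)"
    and "simulates C C'" and inv: "table_inv M" and no_stubs: "stubs M = {}"
  shows "table_inv M1 \<and> stubs M1 = {} \<and> (\<exists>C1. step_D sub (C, P) (C1, P) \<and> simulates C1 C1')"
  using assms(1)
proof (cases rule: step.cases)
  case (step_Const E i p ss F)
  then have "\<exists>C1. step_D sub (C, P) (C1, P) \<and> simulates C1 ((E @ [IntV p], ss) # F)"
    using assms(2) by (intro simulates_exec) (auto intro: step.step_Const)
  then show ?thesis using inv no_stubs step_Const by simp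
next
  case (step_Move j E i ss F)
  then have "\<exists>C1. step_D sub (C, P) (C1, P) \<and> simulates C1 ((E @ [E ! j], ss) # F)"
    using assms(2) by (intro simulates_exec) (auto intro: step.step_Move)
  then show ?thesis using inv no_stubs step_Move by simp
next
  case (step_New E ks i T ss F)
  then have "\<exists>C1. step_D sub (C, P) (C1, P) \<and> simulates C1 ((E @ [Obj T (regs E ks)], ss) # F)"
    using assms(2) by (intro simulates_exec) (auto intro: step.step_New)
  then show ?thesis using inv no_stubs step_New by simp
next
  case (step_Field j E T vs k i ss F)
  then have "\<exists>C1. step_D sub (C, P) (C1, P) \<and> simulates C1 ((E @ [vs ! k], ss) # F)"
    using assms(2) by (intro simulates_exec) (auto intro: step.step_Field)
  then show ?thesis using inv no_stubs step_Field by simp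
next
  case (step_Call_skip j E l i m ks ss F)
  then have "\<exists>C1. step_D sub (C, P) (C1, P) \<and> simulates C1 ((E @ [E ! l], ss) # F)"
    using assms(2) by (intro simulates_exec) (auto intro: step.step_Call_skip)
  then show ?thesis using inv no_stubs step_Call_skip by simp
next
  case (step_DirectCall_skip j E l i m Ts ks ss F)
  then have "\<exists>C1. step_D sub (C, P) (C1, P) \<and> simulates C1 ((E @ [E ! l], ss) # F)"
    using assms(2) by (intro simulates_exec) (auto intro: step.step_Call_skip)
  then show ?thesis using inv no_stubs step_DirectCall_skip by simp
next
  case (step_Call j E ks Ts m e i l ss' F')
  \<comment> \<open>Compilation precedes dispatch, so the comparison with \<open>P\<close> takes
    place in the new table \<open>M1\<close>.\<close>
  have inv1: "table_inv M1" "stubs M1 = {}"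
    using compile_preserves_inv(3)[OF \<open>jit sub infer M m Ts M1\<close>] inv no_stubs by auto
  obtain e0 where e0: "dispatch sub P m Ts = Some e0" "compiled Ts (mbody e0) (mbody e)"
    using dispatch_compiled[OF inv1 \<open>dispatch sub M1 m Ts = Some e\<close>] .
  obtain ss F where C: "C = (E, Call i j m ks l # ss) # F"
    using assms(2) step_Call by (auto elim!: simulates_ConsE simp: list_all2_Cons2)
  have st: "step_D sub (C, P) ((regs E ks, mbody e0) # C, P)"
    unfolding C using step_Call e0 by (auto intro!: step.step_Call simp: no_jit_def)
  show ?thesis
    using inv1 st simulates_call[of E _ ss F _ ss' F' "regs E ks" "mbody e0" "mbody e"]
      assms(2) step_Call e0 C by blast
next
  case (step_DirectCall j E ks m Ts e i l ss' F')
  \<comment> \<open>The entry looked up has signature exactly \<open>Ts\<close>, so dispatch in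
    \<open>M\<close> would select it too.\<close>
  obtain e0 where e0: "dispatch sub P m Ts = Some e0" "compiled Ts (mbody e0) (mbody e)"
    using dispatch_compiled[OF inv no_stubs] lookup_imp_dispatch step_DirectCall inv
    unfolding table_inv_def by blast
  obtain ss F where C: "C = (E, Call i j m ks l # ss) # F"
    and Ts: "map typeof (regs E ks) = Ts"
    using assms(2) step_DirectCall inferred_concrete_args
    by (auto elim!: simulates_ConsE simp: list_all2_Cons2)
  have st: "step_D sub (C, P) ((regs E ks, mbody e0) # C, P)"
    unfolding C using step_DirectCall e0 Ts by (auto intro!: step.step_Call simp: no_jit_def)
  show ?thesis
    using inv no_stubs st simulates_call[of E _ ss F _ ss' F' "regs E ks" "mbody e0" "mbody e"]
      assms(2) step_DirectCall e0 C Ts by blast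
next
  case (step_Return E' E s' ss' F')
  obtain F1 E0' body' E1' where C: "C = (E', []) # F1" and E': "E' = E0' @ E1'"
    and F1: "simulates F1 ((E, s' # ss') # F')"
    and callee: "F1 = [] \<or> step_D sub (F1, P) ((E0', body') # F1, P)"
      "(step_D sub)\<^sup>*\<^sup>* ((E0', body') # F1, P) ((E', []) # F1, P)"
    using assms(2) unfolding step_Return(1) by (rule simulates_ConsE) (rule that; simp)
  obtain F E0 body ts E1 s ss where F1_eq: "F1 = (E, s # ss) # F" and E: "E = E0 @ E1"
    and F: "simulates F F'" "F = [] \<or> step_D sub (F, P) ((E0, body) # F, P)"
      "infer P (map Conc (map typeof E0)) body = Some ts"
      "(step_D sub)\<^sup>*\<^sup>* ((E0, body) # F, P) ((E0 @ E1, s # ss) # F, P)"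
      "list_all2 (instr_refines (map Conc (map typeof E0) @ ts)) ss ss'"
    by (rule simulates_instrE[OF F1])
  have st: "step_D sub (C, P) ((E @ [last E'], ss) # F, P)"
    unfolding C F1_eq using step_Return by (auto intro!: step.step_Return)
  \<comment> \<open>Entering the callee, its run and the return form one run of the caller past its
    call; \<open>F1\<close> is non-empty, so the callee was entered by a step.\<close>
  have "(step_D sub)\<^sup>*\<^sup>* ((E, s # ss) # F, P) ((E @ [last E'], ss) # F, P)"
    using callee st unfolding F1_eq C by (auto intro: converse_rtranclp_into_rtranclp)
  then have "simulates ((E @ [last E'], ss) # F) ((E @ [last E'], ss') # F')"
    using simulates_advance[OF F] unfolding E by blast
  with st show ?thesis using inv no_stubs step_Return by auto
qed

lemma step_JIT_progress:
  assumes main: "infer P [] ss = Some ts"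
    and reach: "(step_JIT sub infer)\<^sup>*\<^sup>* ([([], ss)], P) (C', M)"
    and sim: "simulates C C'" and inv: "table_inv M"
    and st: "step_D sub (C, P) c"
  shows "\<exists>c'. step_JIT sub infer (C', M) c'"
proof (rule ccontr)
  assume stuck: "\<nexists>c'. step_JIT sub infer (C', M) c'"
  \<comment> \<open>Otherwise \<open>C\<close> would be equally empty or final and could not
    step.\<close>
  have "C' \<noteq> []" "\<nexists>E. C' = [(E, [])]"
    using sim st by (auto elim!: simulates.cases step.cases)
  then have "erred sub (C', M)"
    using sound_JIT finite_P main reach stuck unfolding sound_for_def
    by (metis append_Nil2 list.simps(8) list_sub_refl)
  then obtain E i j m ks l ss' F' where C': "C' = (E, Call i j m ks l # ss') # F'"
    and undef: "dispatch sub M m (map typeof (regs E ks)) = None"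
    by (auto simp: erred_def)
  obtain ss F where C: "C = (E, Call i j m ks l # ss) # F"
    using sim C' by (auto elim!: simulates_ConsE simp: list_all2_Cons2)
  \<comment> \<open>The dispatch step is either a skip, which the JIT run could also take, or a call
    whose dispatch in \<open>P\<close> succeeds, and then dispatch in \<open>M\<close> is
    defined.\<close>
  show False
    using st unfolding C
  proof (cases rule: step.cases)
    case step_Call_skip
    then show False using stuck step.step_Call_skip unfolding C' by blast
  next
    case (step_Call Ts M' e)
    then show False using dispatch_defined[OF inv, of m Ts e] undef by (simp add: no_jit_def)
  qed
qed

section \<open>From steps to runs\<close>

lemma JIT_run_simulated:
  assumes "(step_JIT sub infer)\<^sup>*\<^sup>* (C', M) (C1', M1)"
    and "simulates C C'" "table_inv M" "stubs M = {}"
  shows "\<exists>C1. (step_D sub)\<^sup>*\<^sup>* (C, P) (C1, P) \<and> simulates C1 C1'"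
  using assms
proof (induction "(C', M)" arbitrary: C' M C rule: converse_rtranclp_induct)
  case base
  then show ?case by blast
next
  case (step c')
  obtain C2' M2 where c': "c' = (C2', M2)" by (rule prod.exhaust)
  obtain C2 where C2: "step_D sub (C, P) (C2, P)" "simulates C2 C2'"
    "table_inv M2" "stubs M2 = {}"
    using step_JIT_simulated[OF step(1)[unfolded c'] step(4-6)] by auto
  obtain C1 where "(step_D sub)\<^sup>*\<^sup>* (C2, P) (C1, P)" "simulates C1 C1'"
    using step(3)[OF c' C2(2-4)] by auto
  with C2(1) show ?case by (auto intro: converse_rtranclp_into_rtranclp)
qed

text \<open>The JIT run from the initial configuration is carried through the induction, because
  progress applies soundness to that whole run.\<close>

lemma dispatch_run_simulated:
  assumes main: "infer P [] ss = Some ts"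
    and "(step_D sub)\<^sup>*\<^sup>* (C, P) (C1, N)"
    and "(step_JIT sub infer)\<^sup>*\<^sup>* ([([], ss)], P) (C', M)"
    and "simulates C C'" "table_inv M" "stubs M = {}"
  shows "\<exists>C1' M1. (step_JIT sub infer)\<^sup>*\<^sup>* ([([], ss)], P) (C1', M1) \<and> simulates C1 C1'"
  using assms(2-)
proof (induction "(C, P)" arbitrary: C C' M rule: converse_rtranclp_induct)
  case base
  then show ?case by blast
next
  case (step c)
  obtain c' where "step_JIT sub infer (C', M) c'"
    using step_JIT_progress[OF main step(4-6) step(1)] by blast
  then obtain C2' M2 where jit: "step_JIT sub infer (C', M) (C2', M2)"
    by (cases c') simp
  obtain C2 where C2: "step_D sub (C, P) (C2, P)" "simulates C2 C2'"
    "table_inv M2" "stubs M2 = {}"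
    using step_JIT_simulated[OF jit step(5-7)] by auto
  \<comment> \<open>Determinism turns the step that matches the JIT step into the given one.\<close>
  have "c = (C2, P)" using step_no_jit_functional[OF step(1) C2(1)] .
  moreover have "(step_JIT sub infer)\<^sup>*\<^sup>* ([([], ss)], P) (C2', M2)"
    using step(4) jit by (rule rtranclp.rtrancl_into_rtrancl)
  ultimately show ?case using step(3) C2 by simp
qed

section \<open>Initial and final configurations, and the equivalence\<close>

lemma simulates_main:
  assumes "Entry m [] ss [] \<in> P"
  shows "simulates [([], ss)] [([], ss)]" and "\<exists>ts. infer P [] ss = Some ts"
proof -
  have "compiled [] ss ss" using compiled_refl[OF assms, of "[]"] by simp
  then show "\<exists>ts. infer P [] ss = Some ts" and "simulates [([], ss)] [([], ss)]"
    using simulates_Cons[OF simulates_Nil, of "[]" ss _ "[]" ss ss] by (auto simp: compiled_def)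
qed

lemma simulates_final:
  "simulates [(E, [])] C' \<Longrightarrow> C' = [(E, [])]"
  "simulates C [(E, [])] \<Longrightarrow> C = [(E, [])]"
  by (auto elim!: simulates.cases)

end

theorem theorem4p16:
  fixes D :: type_table and sub :: subtype_rel and infer :: inference
    and M :: mtable and ss :: "instr list" and E :: env
  assumes "type_inference D sub infer"
    and "finite M"
    and "WF D sub infer M"
    and "originals M = M"
    and "Entry ''main'' [] ss [] \<in> M"
  shows "(step_D sub)\<^sup>*\<^sup>* ([([], ss)], M) ([(E, [])], M)
    \<longleftrightarrow> (\<exists>M'. (step_JIT sub infer)\<^sup>*\<^sup>* ([([], ss)], M) ([(E, [])], M'))"
proof -
  interpret jit_program D sub infer M
    using assms by (simp add: jit_program_def jit_program_axioms_def)
  note main = simulates_main[OF assms(5)]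
  show ?thesis
  proof
    assume "(step_D sub)\<^sup>*\<^sup>* ([([], ss)], M) ([(E, [])], M)"
    then show "\<exists>M'. (step_JIT sub infer)\<^sup>*\<^sup>* ([([], ss)], M) ([(E, [])], M')"
      using dispatch_run_simulated[OF _ _ rtranclp.rtrancl_refl main(1) table_inv_P stubs_P]
        main(2) simulates_final(1) by blast
  next
    assume "\<exists>M'. (step_JIT sub infer)\<^sup>*\<^sup>* ([([], ss)], M) ([(E, [])], M')"
    then show "(step_D sub)\<^sup>*\<^sup>* ([([], ss)], M) ([(E, [])], M)"
      using JIT_run_simulated[OF _ main(1) table_inv_P stubs_P] simulates_final(2) by blast
  qed
qed

end
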